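(* Let $W^1,\dots,W^m$ be independent standard Brownian motions. Fix $0<\tau<\tau'<\infty$ and constants $c>0$ and $0<p<p_0(c):=\tfrac14(1-\Phi(c))$. Then there exists $0<h\le1$ such that, for any $\delta\in(0,1)$, if $$m\ge\frac4p\log\Big(\frac{\lceil\log(\tau'/\tau)/h\rceil}{\delta}\Big),\qquad( * )$$ then with probability at least $1-\delta$, $$\inf_{t\in[\tau,\tau']}\frac1m\sum_{j=1}^m\mathbf 1\big\{W^j(t)/\sqrt t\ge c\big\}\ge p .$$ Furthermore, define $$\varepsilon:=\frac{\Phi^{-1}(1-4p)-c}{3},\qquad h_\star:=\min\Big\{1,\ 2\log\Big(\frac{c+3\varepsilon}{c+2\varepsilon}\Big),\ \log\Big(1+\frac{2\varepsilon^2}{\log 8}\Big)\Big\}.$$ Then the conclusion (for any $\delta\in(0,1)$, the condition $( * )$ on $m$ implies the stated probability bound) holds for any choice of $h\in(0,h_\star]$. In particular, if $c\le1/20$ and $p\le1/10$, then the choice $h=1/250$ is admissible (i.e. $1/250\le h_\star$).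
   Context: $\Phi$ denotes the standard normal cumulative distribution function and $\Phi^{-1}$ its inverse. *)

theory Defs
  imports "HOL-Probability.Probability"
begin

(* Processes are total functions on the reals; only times t \<ge> 0 are constrained.
   Continuity of paths and W 0 = 0 are required almost surely.
   The second argument of normal_density is the standard deviation. *)

definition standard_brownian_motion :: "'a measure \<Rightarrow> (real \<Rightarrow> 'a \<Rightarrow> real) \<Rightarrow> bool" where
  "standard_brownian_motion M W \<longleftrightarrow>
     prob_space M \<and>
     (\<forall>t\<ge>0. W t \<in> borel_measurable M) \<and>
     (AE \<omega> in M. W 0 \<omega> = 0) \<and>
     (\<forall>(n::nat) ts. 0 \<le> ts 0 \<longrightarrow> (\<forall>i<n. ts i < ts (Suc i)) \<longrightarrow>
        prob_space.indep_vars M (\<lambda>_. borel) (\<lambda>i \<omega>. W (ts (Suc i)) \<omega> - W (ts i) \<omega>) {..<n}) \<and>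
     (\<forall>s t. 0 \<le> s \<longrightarrow> s < t \<longrightarrow>
        distributed M lborel (\<lambda>\<omega>. W t \<omega> - W s \<omega>) (normal_density 0 (sqrt (t - s)))) \<and>
     (AE \<omega> in M. continuous_on {0..} (\<lambda>t. W t \<omega>))"

(* Joint independence of whole processes, each viewed as a random element of the
   product space of real functions on [0, \<infinity>). *)

definition independent_processes ::
    "'a measure \<Rightarrow> 'i set \<Rightarrow> ('i \<Rightarrow> real \<Rightarrow> 'a \<Rightarrow> real) \<Rightarrow> bool" where
  "independent_processes M I W \<longleftrightarrow>
     prob_space.indep_vars M (\<lambda>_. Pi\<^sub>M {0..} (\<lambda>_. borel))
       (\<lambda>j \<omega>. \<lambda>t\<in>{0..}. W j t \<omega>) I"

definition \<Phi> :: "real \<Rightarrow> real" where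
  "\<Phi> = cdf std_normal_distribution"

(* inv \<Phi> is meaningful on (0, 1), the range of \<Phi>. *)

definition \<Phi>_inv :: "real \<Rightarrow> real" where
  "\<Phi>_inv = inv \<Phi>"

definition p0 :: "real \<Rightarrow> real" where
  "p0 c = 1 / 4 * (1 - \<Phi> c)"

definition eps :: "real \<Rightarrow> real \<Rightarrow> real" where
  "eps c p = (\<Phi>_inv (1 - 4 * p) - c) / 3"

definition h_star :: "real \<Rightarrow> real \<Rightarrow> real" where
  "h_star c p =
     min 1 (min (2 * ln ((c + 3 * eps c p) / (c + 2 * eps c p)))
                (ln (1 + 2 * (eps c p)\<^sup>2 / ln 8)))"

(* The number m of Brownian motions and the level \<delta> are quantified here, after h.
   The infimum is over an uncountable set of times and paths are continuous only almost
   surely, so the event is measured in the completion of M, which agrees with M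
   on the events of M. *)

definition uniform_fraction_bound ::
    "'a measure \<Rightarrow> real \<Rightarrow> real \<Rightarrow> real \<Rightarrow> real \<Rightarrow> real \<Rightarrow> bool" where
  "uniform_fraction_bound M \<tau> \<tau>' c p h \<longleftrightarrow>
     (\<forall>(m::nat) (W :: nat \<Rightarrow> real \<Rightarrow> 'a \<Rightarrow> real) \<delta>.
        (\<forall>j\<in>{1..m}. standard_brownian_motion M (W j)) \<longrightarrow>
        independent_processes M {1..m} W \<longrightarrow>
        0 < \<delta> \<longrightarrow> \<delta> < 1 \<longrightarrow>
        real m \<ge> 4 / p * ln (real_of_int \<lceil>ln (\<tau>' / \<tau>) / h\<rceil> / \<delta>) \<longrightarrow>
        measure (completion M)
          {\<omega> \<in> space M.
             (INF t\<in>{\<tau>..\<tau>'}. 1 / real m * (\<Sum>j=1..m. of_bool (W j t \<omega> / sqrt t \<ge> c))) \<ge> p}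
          \<ge> 1 - \<delta>)"

end

theory Submission
  imports Defs
begin

text \<open>Cut the time range at the points \<open>\<tau> exp (i h)\<close>. On one block starting at \<open>s\<close>, a
  Brownian motion with \<open>W s \<ge> (c + 3 \<epsilon>) sqrt s\<close>, an event of probability \<open>4 p\<close>, stays above
  \<open>c sqrt t\<close> unless it drops by more than \<open>2 \<epsilon> sqrt (s exp h)\<close>; by Levy's inequality and Chebyshev's
  inequality this drop has probability at most one half. A Chernoff bound over the \<open>m\<close> independent
  motions and a union bound over the blocks conclude. All of this is carried out for a finite set of
  times; a limit gives the rational times, and continuity of the paths gives all times.\<close>

section \<open>Symmetry of centered normal variables\<close>

text \<open>\<open>- X\<close> has the same centered normal law as \<open>X\<close>.\<close>

lemma (in prob_space) centered_normal_tails_eq: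
  assumes X: "distributed M lborel X (normal_density 0 \<sigma>)" and "0 < \<sigma>"
  shows "prob {\<omega> \<in> space M. X \<omega> \<le> - a} = prob {\<omega> \<in> space M. a \<le> X \<omega>}"
proof -
  have X': "distributed M lborel (\<lambda>\<omega>. - X \<omega>) (normal_density 0 \<sigma>)"
    using normal_density_affine[OF X \<open>0 < \<sigma>\<close>, of "-1" 0] by simp
  have [measurable]: "X \<in> borel_measurable M"
    using X by (simp add: distributed_def)
  have "prob {\<omega> \<in> space M. a \<le> X \<omega>} = measure (distr M lborel X) {a..}"
    by (subst measure_distr) (auto intro!: arg_cong[where f = prob])
  also have "distr M lborel X = distr M lborel (\<lambda>\<omega>. - X \<omega>)"
    using X X' by (simp add: distributed_def)
  also have "measure \<dots> {a..} = prob {\<omega> \<in> space M. X \<omega> \<le> - a}"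
    by (subst measure_distr) (auto intro!: arg_cong[where f = prob])
  finally show ?thesis ..
qed

text \<open>The events \<open>0 \<le> X\<close> and \<open>X \<le> 0\<close> cover the space and are
  equally likely by symmetry.\<close>

lemma (in prob_space) centered_normal_nonneg_prob:
  assumes X: "distributed M lborel X (normal_density 0 \<sigma>)" and "0 < \<sigma>"
  shows "prob {\<omega> \<in> space M. 0 \<le> X \<omega>} \<ge> 1 / 2"
proof -
  have [measurable]: "X \<in> borel_measurable M"
    using X by (simp add: distributed_def)
  have "1 = prob ({\<omega> \<in> space M. 0 \<le> X \<omega>} \<union> {\<omega> \<in> space M. X \<omega> \<le> - 0})"
    by (subst prob_space[symmetric]) (auto intro!: arg_cong[where f = prob])
  also have "\<dots> \<le> prob {\<omega> \<in> space M. 0 \<le> X \<omega>} + prob {\<omega> \<in> space M. X \<omega> \<le> - 0}"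
    by (intro measure_Un_le) auto
  finally show ?thesis
    unfolding centered_normal_tails_eq[OF assms] by simp
qed

section \<open>The standard normal distribution function and normal tails\<close>

interpretation std_normal: real_distribution std_normal_distribution
  by (rule real_dist_normal_dist)

text \<open>The density never exceeds its value 1 / sqrt (2 pi) at the origin.\<close>

lemma std_normal_Ioc_le:
  assumes "a \<le> b"
  shows "measure std_normal_distribution {a<..b} \<le> (b - a) / sqrt (2 * pi)"
proof -
  have "emeasure std_normal_distribution {a<..b}
      = (\<integral>\<^sup>+ x. ennreal (std_normal_density x) * indicator {a<..b} x \<partial>lborel)"
    by (subst emeasure_density) auto
  also have "\<dots> \<le> (\<integral>\<^sup>+ x. ennreal (1 / sqrt (2 * pi)) * indicator {a<..b} x \<partial>lborel)"
    by (intro nn_integral_mono mult_right_mono ennreal_leI)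
       (auto simp: std_normal_density_def divide_simps)
  also have "\<dots> = ennreal ((b - a) / sqrt (2 * pi))"
    using assms by (subst nn_integral_cmult_indicator) (auto simp flip: ennreal_mult)
  finally show ?thesis
    using assms by (simp add: std_normal.emeasure_eq_measure)
qed

lemma std_normal_singleton: "measure std_normal_distribution {x} = 0"
proof -
  have "emeasure std_normal_distribution {x} = 0"
    by (subst emeasure_density) (auto simp: nn_integral_0_iff_AE AE_lborel_singleton
      intro!: AE_I'[of "{x}"] split: split_indicator)
  then show ?thesis by (simp add: measure_def)
qed

lemma \<Phi>_mono: "x \<le> y \<Longrightarrow> \<Phi> x \<le> \<Phi> y"
  unfolding \<Phi>_def by (rule std_normal.cdf_nondecreasing)

text \<open>As \<open>\<Phi>_inv\<close> is an inverse by choice, it suffices that \<open>q\<close>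
  lies in the range of \<open>\<Phi>\<close>. This is the intermediate value theorem:
  \<open>\<Phi>\<close> tends to 0 and 1 at the two infinities and is continuous because the law has
  no atoms.\<close>

lemma \<Phi>_inv_cancel:
  assumes "0 < q" "q < 1"
  shows "\<Phi> (\<Phi>_inv q) = q"
proof -
  have cont: "isCont \<Phi> x" for x
    unfolding \<Phi>_def std_normal.isCont_cdf by (rule std_normal_singleton)
  have "eventually (\<lambda>x. \<Phi> x < q \<and> x \<le> 0) at_bot"
    unfolding \<Phi>_def using order_tendstoD(2)[OF std_normal.cdf_lim_at_bot \<open>0 < q\<close>]
    by (intro eventually_conj eventually_le_at_bot) auto
  then obtain a where a: "\<Phi> a < q" "a \<le> 0"
    by (auto simp: eventually_at_bot_linorder)
  have "eventually (\<lambda>x. q < \<Phi> x \<and> 0 \<le> x) at_top"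
    unfolding \<Phi>_def using order_tendstoD(1)[OF std_normal.cdf_lim_at_top_prob \<open>q < 1\<close>]
    by (intro eventually_conj eventually_ge_at_top) auto
  then obtain b where b: "q < \<Phi> b" "0 \<le> b"
    by (auto simp: eventually_at_top_linorder)
  have "\<exists>x\<ge>a. x \<le> b \<and> \<Phi> x = q"
    using a b cont by (intro IVT) auto
  then have "q \<in> range \<Phi>" by auto
  then show ?thesis unfolding \<Phi>_inv_def by (rule f_inv_into_f)
qed

text \<open>Symmetry gives \<open>\<Phi> 0\<close> at most 1/2, and the bound on the density
  controls the mass of the interval from 0 to \<open>x\<close>. The estimate serves to bound the
  quantile from below numerically.\<close>

lemma \<Phi>_le:
  assumes "0 \<le> x"
  shows "\<Phi> x \<le> 1 / 2 + x / sqrt (2 * pi)"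
proof -
  \<comment> \<open>The identity is a standard normal variable on the real line with its normal law,
    so the symmetry lemma applies to it.\<close>
  have "distributed std_normal_distribution lborel (\<lambda>x. x) (normal_density 0 1)"
    by (auto simp: distributed_def intro!: measure_eqI simp: emeasure_distr)
  then have "measure std_normal_distribution {0..} \<ge> 1 / 2"
    using std_normal.centered_normal_nonneg_prob[of "\<lambda>x. x" 1]
    by (simp add: atLeast_def)
  moreover have "measure std_normal_distribution {0..}
      \<le> measure std_normal_distribution {0} + measure std_normal_distribution {0<..}"
    by (subst (1) ivl_disj_un_singleton(1)[symmetric]) (rule measure_Un_le, auto)
  moreover have "measure std_normal_distribution {0<..} = 1 - \<Phi> 0"
    using std_normal.prob_compl[of "{..0}"] by (simp add: \<Phi>_def cdf_def Compl_eq_Diff_UNIV[symmetric])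
  moreover have "\<Phi> x = \<Phi> 0 + measure std_normal_distribution {0<..x}"
    unfolding \<Phi>_def using std_normal.cdf_diff_eq[of 0 x] assms by (cases "x = 0") auto
  ultimately show ?thesis
    using std_normal_Ioc_le[OF assms] by (simp add: std_normal_singleton)
qed

text \<open>After division by \<open>\<sigma>\<close> the variable is standard normal, and the
  complement of \<open>X \<le> x * \<sigma>\<close> is contained in the closed tail event.\<close>

lemma (in prob_space) centered_normal_tail_ge:
  assumes X: "distributed M lborel X (normal_density 0 \<sigma>)" and "0 < \<sigma>"
  shows "prob {\<omega> \<in> space M. x * \<sigma> \<le> X \<omega>} \<ge> 1 - \<Phi> x"
proof -
  have [measurable]: "X \<in> borel_measurable M"
    using X by (simp add: distributed_def)
  have "distributed M lborel (\<lambda>\<omega>. X \<omega> / \<sigma>) std_normal_density"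
    using normal_standard_normal_convert[OF \<open>0 < \<sigma>\<close>, of X 0] X by simp
  then have "std_normal_distribution = distr M lborel (\<lambda>\<omega>. X \<omega> / \<sigma>)"
    by (simp add: distributed_def)
  then have "\<Phi> x = measure (distr M lborel (\<lambda>\<omega>. X \<omega> / \<sigma>)) {..x}"
    by (simp add: \<Phi>_def cdf_def)
  also have "\<dots> = prob {\<omega> \<in> space M. X \<omega> \<le> x * \<sigma>}"
    using \<open>0 < \<sigma>\<close> by (subst measure_distr) (auto intro!: arg_cong[where f = prob] simp: field_simps)
  finally have "1 - \<Phi> x = prob {\<omega> \<in> space M. \<not> X \<omega> \<le> x * \<sigma>}"
    by (subst prob_neg) auto
  also have "\<dots> \<le> prob {\<omega> \<in> space M. x * \<sigma> \<le> X \<omega>}"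
    by (intro finite_measure_mono) auto
  finally show ?thesis .
qed

lemma (in prob_space) centered_normal_Chebyshev:
  assumes X: "distributed M lborel X (normal_density 0 \<sigma>)" and "0 < \<sigma>" "0 < a"
  shows "prob {\<omega> \<in> space M. X \<omega> < - a} \<le> \<sigma>\<^sup>2 / a\<^sup>2"
proof -
  have [measurable]: "X \<in> borel_measurable M"
    using X by (simp add: distributed_def)
  have E: "expectation X = 0"
    using normal_distributed_expectation[OF \<open>0 < \<sigma>\<close> X] .
  have V: "variance X = \<sigma>\<^sup>2"
    using normal_distributed_variance[OF \<open>0 < \<sigma>\<close> X] .
  have "integrable lborel (\<lambda>x. normal_density 0 \<sigma> x * (x - 0)^(2 * 1))"
    using integrable_normal_moment[OF \<open>0 < \<sigma>\<close>] .
  then have I: "integrable M (\<lambda>\<omega>. (X \<omega>)\<^sup>2)"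
    using distributed_integrable[OF X, of "\<lambda>x. x\<^sup>2"] by simp
  have "prob {\<omega> \<in> space M. X \<omega> < - a} \<le> prob {\<omega> \<in> space M. a \<le> \<bar>X \<omega> - expectation X\<bar>}"
    by (intro finite_measure_mono) (auto simp: E)
  also have "\<dots> \<le> variance X / a\<^sup>2"
    using I \<open>0 < a\<close> by (intro Chebyshev_inequality) auto
  finally show ?thesis unfolding V .
qed

section \<open>The explicit block length 1/250\<close>

text \<open>The quantile \<open>x\<close> is at least 1/4, because \<open>\<Phi> (1 / 4)\<close> is
  below 1/2 + 1/10, while \<open>\<Phi> x\<close> is at least 3/5. Hence \<open>e\<close> is at
  least (1/4 - 1/20) / 3 = 1/15, which bounds both logarithms from below.\<close>

lemma h_star_numeric:
  assumes "0 < c" "c \<le> 1 / 20" "0 < p" "p \<le> 1 / 10"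
  shows "1 / 250 \<le> h_star c p"
proof -
  define x where "x = \<Phi>_inv (1 - 4 * p)"
  define e where "e = eps c p"
  have e: "e = (x - c) / 3" by (simp add: e_def x_def eps_def)
  have x: "\<Phi> x = 1 - 4 * p"
    unfolding x_def using assms by (intro \<Phi>_inv_cancel) auto
  have s: "5 / 2 < sqrt (2 * pi)"
    using pi_approx(1) by (intro real_less_rsqrt) (simp add: power2_eq_square)
  have "1 / 4 \<le> x"
  proof (rule ccontr)
    assume "\<not> 1 / 4 \<le> x"
    then have "\<Phi> x \<le> \<Phi> (1 / 4)" by (intro \<Phi>_mono) auto
    also have "\<dots> \<le> 1 / 2 + 1 / 4 / sqrt (2 * pi)" by (rule \<Phi>_le) simp
    also have "1 / 4 / sqrt (2 * pi) < 1 / 4 / (5 / 2)" using s by (intro divide_strict_left_mono) auto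
    finally show False using x \<open>p \<le> 1 / 10\<close> by simp
  qed
  then have e_ge: "1 / 15 \<le> e" using e \<open>c \<le> 1 / 20\<close> by simp
  have ln8: "0 < ln (8 :: real)" "ln (8 :: real) \<le> 25 / 12"
  proof -
    have "ln (2 ^ 3 :: real) = 3 * ln 2" by (subst ln_realpow) auto
    then show "ln (8 :: real) \<le> 25 / 12" using ln2_le_25_over_36 by simp
  qed simp
  have "1 / 250 \<le> 1 / 3 - (1 / 3 :: real)\<^sup>2" by (simp add: power2_eq_square)
  also have "\<dots> \<le> ln (1 + 1 / 3)" by (rule ln_one_plus_pos_lower_bound) auto
  \<comment> \<open>The quotient is at least 4/3 exactly when \<open>c \<le> e\<close>, and here c
    is at most 1/20 and e at least 1/15.\<close>
  also have "\<dots> \<le> ln ((c + 3 * e) / (c + 2 * e))"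
    using e_ge assms by (intro ln_mono) (auto simp: field_simps)
  finally have 1: "1 / 250 \<le> 2 * ln ((c + 3 * e) / (c + 2 * e))" by simp
  have "16 / 3750 = 2 * (1 / 15)\<^sup>2 / (25 / 12 :: real)" by (simp add: power2_eq_square)
  also have "\<dots> \<le> 2 * e\<^sup>2 / ln 8"
    using e_ge ln8 by (intro frac_le mult_left_mono power_mono) auto
  finally have y: "16 / 3750 \<le> 2 * e\<^sup>2 / ln 8" .
  \<comment> \<open>This term comes close to 1/250: the value 16/3750 is about 0.00427, and the
    quadratic correction leaves about 0.00425.\<close>
  have "1 / 250 \<le> 16 / 3750 - (16 / 3750 :: real)\<^sup>2" by (simp add: power2_eq_square)
  also have "\<dots> \<le> ln (1 + 16 / 3750)" by (rule ln_one_plus_pos_lower_bound) auto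
  also have "\<dots> \<le> ln (1 + 2 * e\<^sup>2 / ln 8)" using y by (intro ln_mono) auto
  finally show ?thesis using 1 by (simp add: h_star_def flip: e_def)
qed

section \<open>Maximal inequality and Chernoff bound\<close>

lemma sets_Collect_ball_ge:
  fixes S :: "'i \<Rightarrow> 'a \<Rightarrow> real"
  assumes "finite I" "\<And>i. i \<in> I \<Longrightarrow> S i \<in> borel_measurable N"
  shows "{\<omega> \<in> space N. \<forall>i\<in>I. b i \<le> S i \<omega>} \<in> sets N"
  using assms by (intro sets.sets_Collect_finite_All borel_measurable_le) auto

text \<open>The space \<open>N\<close> is arbitrary so that the lemma serves both for events in
  \<open>M\<close> and for sets of coordinate functions in a product space.\<close>

lemma sets_Collect_first_passage:
  fixes S :: "nat \<Rightarrow> 'a \<Rightarrow> real"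
  assumes S: "\<And>l. l \<le> k \<Longrightarrow> S l \<in> borel_measurable N"
  shows "{\<omega> \<in> space N. (\<forall>l<k. b \<le> S l \<omega>) \<and> S k \<omega> < b} \<in> sets N"
proof -
  have "{\<omega> \<in> space N. \<forall>l\<in>{..<k}. b \<le> S l \<omega>} \<in> sets N"
    using S by (intro sets_Collect_ball_ge) auto
  moreover have "{\<omega> \<in> space N. S k \<omega> < b} \<in> sets N"
    using S by (intro borel_measurable_less) auto
  ultimately have "{\<omega> \<in> space N. \<forall>l\<in>{..<k}. b \<le> S l \<omega>} \<inter> {\<omega> \<in> space N. S k \<omega> < b} \<in> sets N"
    by (rule sets.Int)
  also have "{\<omega> \<in> space N. \<forall>l\<in>{..<k}. b \<le> S l \<omega>} \<inter> {\<omega> \<in> space N. S k \<omega> < b}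
      = {\<omega> \<in> space N. (\<forall>l<k. b \<le> S l \<omega>) \<and> S k \<omega> < b}"
    by auto
  finally show ?thesis .
qed

text \<open>After the first passage below \<open>- a\<close> the remaining increment is nonpositive with
  probability at least one half.\<close>

lemma (in prob_space) Levy_maximal_inequality:
  fixes X :: "nat \<Rightarrow> 'a \<Rightarrow> real"
  assumes ind: "indep_vars (\<lambda>_. borel) X {..<n}"
    and half: "\<And>k. k < n \<Longrightarrow> prob {\<omega> \<in> space M. (\<Sum>i\<in>{k..<n}. X i \<omega>) \<le> 0} \<ge> 1 / 2"
  assumes a: "0 \<le> a"
  shows "prob {\<omega> \<in> space M. \<exists>k\<le>n. (\<Sum>i<k. X i \<omega>) < - a}
    \<le> 2 * prob {\<omega> \<in> space M. (\<Sum>i<n. X i \<omega>) < - a}"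
proof -
  \<comment> \<open>\<open>P k f\<close> says that \<open>k\<close> is the first index at which the
    partial sums of \<open>f\<close> fall below \<open>- a\<close>. It is a predicate on sequences,
    so that it applies to the variables and to the coordinates of a product space alike.\<close>
  define P where "P k f \<longleftrightarrow> (\<forall>l<k. - a \<le> (\<Sum>i<l. f i)) \<and> (\<Sum>i<k. f i) < - a"
    for k and f :: "nat \<Rightarrow> real"
  define A where "A k = {\<omega> \<in> space M. P k (\<lambda>i. X i \<omega>)}" for k
  define B where "B k = {\<omega> \<in> space M. (\<Sum>i\<in>{k..<n}. X i \<omega>) \<le> 0}" for k
  have X[measurable]: "i < n \<Longrightarrow> X i \<in> borel_measurable M" for i
    using ind by (auto simp: indep_vars_def)
  have S[measurable]: "(\<lambda>\<omega>. \<Sum>i<k. X i \<omega>) \<in> borel_measurable M" if "k \<le> n" for k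
    using that by (intro borel_measurable_sum) auto
  have S'[measurable]: "(\<lambda>\<omega>. \<Sum>i=k..<n. X i \<omega>) \<in> borel_measurable M" for k
    by (intro borel_measurable_sum) auto
  have A[measurable]: "A k \<in> events" if "k \<le> n" for k
    using that unfolding A_def P_def by (intro sets_Collect_first_passage S) auto
  have B[measurable]: "B k \<in> events" for k
    unfolding B_def by measurable
  \<comment> \<open>\<open>A k\<close> depends on the first \<open>k\<close> variables and
    \<open>B k\<close> on the remaining ones. Both are preimages of sets of coordinate functions, to
    which the independence of the two groups applies.\<close>
  have AB: "prob (A k \<inter> B k) = prob (A k) * prob (B k)" if "k \<le> n" for k
  proof -
    let ?N = "\<lambda>I. Pi\<^sub>M I (\<lambda>_::nat. borel :: real measure)"
    let ?R = "\<lambda>I \<omega>. \<lambda>i\<in>I. X i \<omega>"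
    let ?C = "{f \<in> space (?N {..<k}). P k f}"
    let ?D = "{f \<in> space (?N {k..<n}). (\<Sum>i\<in>{k..<n}. f i) \<le> 0}"
    have iv: "indep_var (?N {..<k}) (?R {..<k}) (?N {k..<n}) (?R {k..<n})"
      using \<open>k \<le> n\<close> by (intro indep_var_restrict[OF ind]) auto
    have "(\<lambda>f. \<Sum>i<l. f i) \<in> borel_measurable (?N {..<k})" if "l \<le> k" for l
      using that by (intro borel_measurable_sum measurable_component_singleton) auto
    then have C: "?C \<in> sets (?N {..<k})"
      unfolding P_def by (rule sets_Collect_first_passage)
    have D: "?D \<in> sets (?N {k..<n})"
      by measurable
    have eqC: "?R {..<k} -` ?C \<inter> space M = A k"
      by (auto simp: A_def P_def space_PiM)
    have eqD: "?R {k..<n} -` ?D \<inter> space M = B k"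
      by (auto simp: B_def space_PiM)
    have "(\<lambda>x. (?R {..<k} x, ?R {k..<n} x)) -` (?C \<times> ?D) \<inter> space M = A k \<inter> B k"
      unfolding eqC[symmetric] eqD[symmetric] by auto
    with indep_varD[OF iv C D] show ?thesis
      unfolding eqC eqD by simp
  qed
  have disj: "disjoint_family_on A {..n}"
  proof (unfold disjoint_family_on_def, intro ballI impI)
    fix i j :: nat assume "i \<noteq> j"
    then show "A i \<inter> A j = {}"
      by (cases i j rule: linorder_cases) (force simp: A_def P_def)+
  qed
  have sum_split: "(\<Sum>i<n. f i) = (\<Sum>i<k. f i) + (\<Sum>i=k..<n. f i)" if "k \<le> n"
    for k and f :: "nat \<Rightarrow> real"
    using that sum.atLeastLessThan_concat[of 0 k n f] by (simp add: atLeast0LessThan)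
  \<comment> \<open>For \<open>k = n\<close> the sum is empty and \<open>B n\<close> is the whole
    space.\<close>
  have half': "1 / 2 \<le> prob (B k)" if "k \<le> n" for k
    using half[of k] that by (cases "k = n") (auto simp: B_def prob_space)
  have "prob {\<omega> \<in> space M. \<exists>k\<le>n. (\<Sum>i<k. X i \<omega>) < - a} = prob (\<Union>k\<in>{..n}. A k)"
  proof (intro arg_cong[where f = prob] set_eqI iffI)
    fix \<omega> assume \<omega>: "\<omega> \<in> {\<omega> \<in> space M. \<exists>k\<le>n. (\<Sum>i<k. X i \<omega>) < - a}"
    define k where "k = (LEAST k. (\<Sum>i<k. X i \<omega>) < - a)"
    from \<omega> obtain k' where k': "k' \<le> n" "(\<Sum>i<k'. X i \<omega>) < - a" by auto
    then have "k \<le> n" unfolding k_def by (meson Least_le order.trans)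
    moreover have "(\<Sum>i<k. X i \<omega>) < - a" unfolding k_def using k'(2) by (rule LeastI)
    moreover have "- a \<le> (\<Sum>i<l. X i \<omega>)" if "l < k" for l
      using not_less_Least[OF that[unfolded k_def]] by simp
    ultimately show "\<omega> \<in> (\<Union>k\<in>{..n}. A k)"
      using \<omega> by (auto simp: A_def P_def)
  qed (auto simp: A_def P_def)
  also have "\<dots> = (\<Sum>k\<le>n. prob (A k))"
    using disj A by (intro finite_measure_finite_Union) auto
  also have "\<dots> \<le> (\<Sum>k\<le>n. 2 * prob (A k \<inter> B k))"
  proof (intro sum_mono)
    fix k assume "k \<in> {..n}"
    then show "prob (A k) \<le> 2 * prob (A k \<inter> B k)"
      using mult_left_mono[OF half'[of k], of "prob (A k)"] by (simp add: AB)
  qed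
  also have "\<dots> = 2 * prob (\<Union>k\<in>{..n}. A k \<inter> B k)"
  proof -
    have "disjoint_family_on (\<lambda>k. A k \<inter> B k) {..n}"
      using disj by (auto simp: disjoint_family_on_def)
    then show ?thesis
      by (subst finite_measure_finite_Union) (auto simp: sum_distrib_left)
  qed
  \<comment> \<open>A partial sum below \<open>- a\<close> followed by a nonpositive remainder
    leaves the full sum below \<open>- a\<close>.\<close>
  also have "prob (\<Union>k\<in>{..n}. A k \<inter> B k) \<le> prob {\<omega> \<in> space M. (\<Sum>i<n. X i \<omega>) < - a}"
  proof (intro finite_measure_mono subsetI)
    fix \<omega> assume "\<omega> \<in> (\<Union>k\<in>{..n}. A k \<inter> B k)"
    then obtain k where k: "k \<le> n" "\<omega> \<in> A k" "\<omega> \<in> B k" by auto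
    then show "\<omega> \<in> {\<omega> \<in> space M. (\<Sum>i<n. X i \<omega>) < - a}"
      using sum_split[OF k(1), of "\<lambda>i. X i \<omega>"] by (simp add: A_def B_def P_def)
  qed simp
  finally show ?thesis by simp
qed

text \<open>Markov's inequality for the exponential moment with parameter \<open>- ln 2\<close>. For
  values in {0, 1} the factor 2 to the power -Z equals 1 - Z/2, so its expectation is linear in that
  of \<open>Z\<close> and is at most \<open>exp (- p)\<close>.\<close>

lemma (in prob_space) Chernoff_lower_tail:
  assumes I: "finite I" and ind: "indep_vars (\<lambda>_. borel) Z I"
    and Z01: "\<And>i \<omega>. i \<in> I \<Longrightarrow> \<omega> \<in> space M \<Longrightarrow> Z i \<omega> \<in> {0, 1 :: real}"
    and p: "\<And>i. i \<in> I \<Longrightarrow> 2 * p \<le> expectation (Z i)" and "0 \<le> p"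
  shows "prob {\<omega> \<in> space M. (\<Sum>i\<in>I. Z i \<omega>) < p * card I} \<le> exp (- p * card I / 4)"
proof -
  define Y where "Y i \<omega> = 1 - Z i \<omega> / 2" for i \<omega>
  have Zm[measurable]: "i \<in> I \<Longrightarrow> Z i \<in> borel_measurable M" for i
    using ind by (auto simp: indep_vars_def)
  have Zi: "integrable M (Z i)" if "i \<in> I" for i
    using that Z01 by (intro integrable_const_bound[where B = 1]) (auto intro!: AE_I2 dest!: Z01)
  have Yi: "integrable M (Y i)" if "i \<in> I" for i
    unfolding Y_def using Zi[OF that] by auto
  have indY: "indep_vars (\<lambda>_. borel) Y I"
    unfolding Y_def by (rule indep_vars_compose2[OF ind]) auto
  have Y_eq: "Y i \<omega> = exp (- ln 2 * Z i \<omega>)" if "i \<in> I" "\<omega> \<in> space M" for i \<omega>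
    using Z01[OF that] by (auto simp: Y_def exp_minus)
  have prod_eq: "(\<Prod>i\<in>I. Y i \<omega>) = exp (- ln 2 * (\<Sum>i\<in>I. Z i \<omega>))" if "\<omega> \<in> space M" for \<omega>
    using that I by (simp add: Y_eq exp_sum sum_distrib_left cong: prod.cong)
  let ?c = "exp (- ln 2 * (p * card I))"
  have "prob {\<omega> \<in> space M. (\<Sum>i\<in>I. Z i \<omega>) < p * card I}
      \<le> prob {\<omega> \<in> space M. ?c \<le> (\<Prod>i\<in>I. Y i \<omega>)}"
    using borel_measurable_integrable[OF Yi] by (intro finite_measure_mono) (auto simp: prod_eq)
  also have "\<dots> \<le> (\<integral>\<omega>. (\<Prod>i\<in>I. Y i \<omega>) \<partial>M) / ?c"
    using indep_vars_integrable[OF I indY Yi]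
    by (intro integral_Markov_inequality_measure[where A = "{}"]) (auto intro!: AE_I2 simp: prod_eq)
  also have "(\<integral>\<omega>. (\<Prod>i\<in>I. Y i \<omega>) \<partial>M) = (\<Prod>i\<in>I. expectation (Y i))"
    using indep_vars_lebesgue_integral[OF I indY Yi] .
  also have "\<dots> \<le> (\<Prod>i\<in>I. exp (- p))"
  proof (intro prod_mono conjI)
    fix i assume i: "i \<in> I"
    show "0 \<le> expectation (Y i)"
      using i by (intro integral_nonneg_AE AE_I2) (auto simp: Y_eq)
    have "expectation (Y i) = 1 - expectation (Z i) / 2"
      using Zi[OF i] by (simp add: Y_def[abs_def] prob_space)
    also have "\<dots> \<le> 1 + - p" using p[OF i] by simp
    also have "\<dots> \<le> exp (- p)" by (rule exp_ge_add_one_self)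
    finally show "expectation (Y i) \<le> exp (- p)" .
  qed
  also have "(\<Prod>i\<in>I. exp (- p)) = exp (- p * card I)"
    by (simp only: prod_constant exp_of_nat2_mult)
  finally have "prob {\<omega> \<in> space M. (\<Sum>i\<in>I. Z i \<omega>) < p * card I} \<le> exp (- p * card I) / ?c"
    by (simp add: divide_right_mono)
  also have "\<dots> = exp ((ln 2 - 1) * (p * card I))"
    by (subst exp_diff[symmetric], rule arg_cong[where f = exp]) (simp add: algebra_simps)
  \<comment> \<open>Here ln 2 - 1 is at most 25/36 - 1 = -11/36, which is below -1/4.\<close>
  also have "\<dots> \<le> exp (- (1 / 4) * (p * card I))"
    using ln2_le_25_over_36 \<open>0 \<le> p\<close> by (intro iffD2[OF exp_le_cancel_iff] mult_right_mono) auto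
  finally show ?thesis by simp
qed

section \<open>Brownian motion on one block\<close>

lemma brownian_increment_normal:
  assumes "standard_brownian_motion M W" "0 \<le> s" "s < t"
  shows "distributed M lborel (\<lambda>\<omega>. W t \<omega> - W s \<omega>) (normal_density 0 (sqrt (t - s)))"
  using assms by (simp add: standard_brownian_motion_def)

lemma brownian_increments_indep:
  assumes "standard_brownian_motion M W" "0 \<le> u 0" "\<And>i. i < n \<Longrightarrow> u i < u (Suc i)"
  shows "prob_space.indep_vars M (\<lambda>_. borel) (\<lambda>i \<omega>. W (u (Suc i)) \<omega> - W (u i) \<omega>) {..<n}"
  using assms unfolding standard_brownian_motion_def by blast

text \<open>Levy's inequality reduces the deepest drop to the final increment, at the price of a
  factor 2; Chebyshev's inequality bounds the latter by its variance \<open>u n - u 0\<close> over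
  the square of \<open>a\<close>. Every remaining increment is centered normal, hence nonpositive
  with probability at least one half.\<close>

lemma brownian_drop_prob:
  assumes BM: "standard_brownian_motion M W" and "0 \<le> u 0"
    and u: "\<And>i j. i < j \<Longrightarrow> j \<le> n \<Longrightarrow> u i < (u j :: real)" and "0 < a"
  shows "measure M {\<omega> \<in> space M. \<exists>k\<le>n. (\<Sum>i<k. W (u (Suc i)) \<omega> - W (u i) \<omega>) < - a}
    \<le> 2 * ((u n - u 0) / a\<^sup>2)"
proof -
  interpret prob_space M using BM by (simp add: standard_brownian_motion_def)
  have u_nonneg: "0 \<le> u k" if "k \<le> n" for k
    using u[of 0 k] that \<open>0 \<le> u 0\<close> by (cases k) auto
  have "prob {\<omega> \<in> space M. \<exists>k\<le>n. (\<Sum>i<k. W (u (Suc i)) \<omega> - W (u i) \<omega>) < - a}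
      \<le> 2 * prob {\<omega> \<in> space M. (\<Sum>i<n. W (u (Suc i)) \<omega> - W (u i) \<omega>) < - a}"
  proof (rule Levy_maximal_inequality)
    show "indep_vars (\<lambda>_. borel) (\<lambda>i \<omega>. W (u (Suc i)) \<omega> - W (u i) \<omega>) {..<n}"
      using u \<open>0 \<le> u 0\<close> by (intro brownian_increments_indep BM) auto
    fix k assume "k < n"
    then have pos: "0 < sqrt (u n - u k)" using u[of k n] by simp
    have N: "distributed M lborel (\<lambda>\<omega>. W (u n) \<omega> - W (u k) \<omega>) (normal_density 0 (sqrt (u n - u k)))"
      using \<open>k < n\<close> u[of k n] u_nonneg[of k] by (intro brownian_increment_normal[OF BM]) auto
    have tele: "(\<Sum>i=k..<n. W (u (Suc i)) \<omega> - W (u i) \<omega>) = W (u n) \<omega> - W (u k) \<omega>" for \<omega>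
      using \<open>k < n\<close> sum_Suc_diff'[of k n "\<lambda>i. W (u i) \<omega>"] by simp
    show "prob {\<omega> \<in> space M. (\<Sum>i=k..<n. W (u (Suc i)) \<omega> - W (u i) \<omega>) \<le> 0} \<ge> 1 / 2"
      using centered_normal_nonneg_prob[OF N pos] centered_normal_tails_eq[OF N pos, of 0]
      by (simp only: tele minus_zero)
  qed (use \<open>0 < a\<close> in simp)
  moreover have "prob {\<omega> \<in> space M. (\<Sum>i<n. W (u (Suc i)) \<omega> - W (u i) \<omega>) < - a} \<le> (u n - u 0) / a\<^sup>2"
  \<comment> \<open>For \<open>n = 0\<close> there is no normal increment; the empty sum is 0 and
    never below \<open>- a\<close>.\<close>
  proof (cases "n = 0")
    case False
    then have "distributed M lborel (\<lambda>\<omega>. W (u n) \<omega> - W (u 0) \<omega>) (normal_density 0 (sqrt (u n - u 0)))"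
      using u[of 0 n] \<open>0 \<le> u 0\<close> by (intro brownian_increment_normal[OF BM]) auto
    moreover have "(\<Sum>i<n. W (u (Suc i)) \<omega> - W (u i) \<omega>) = W (u n) \<omega> - W (u 0) \<omega>" for \<omega>
      using sum_lessThan_telescope[of "\<lambda>i. W (u i) \<omega>" n] .
    ultimately show ?thesis
      using centered_normal_Chebyshev[OF _ _ \<open>0 < a\<close>, of "\<lambda>\<omega>. W (u n) \<omega> - W (u 0) \<omega>" "sqrt (u n - u 0)"]
        u[of 0 n] False by simp
  qed (use \<open>0 < a\<close> in simp)
  ultimately show ?thesis by linarith
qed

text \<open>The high start \<open>H\<close> and the small drop \<open>G\<close> concern disjoint
  increments, so their probabilities multiply, and \<open>G\<close> has probability at least one
  half. On both events the path is at least \<open>(c + 3 * e) * sqrt s - a\<close>, which by the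
  first condition on \<open>h\<close> is at least \<open>c * sqrt (s * exp h)\<close>.\<close>

lemma brownian_stays_above_finite:
  assumes BM: "standard_brownian_motion M W"
    and "0 < s" "0 < e" "0 \<le> c" "0 \<le> h"
    and h1: "exp (h / 2) * (c + 2 * e) \<le> c + 3 * e" and h2: "exp h - 1 \<le> 2 * e\<^sup>2 / ln 8"
    and F: "finite F" "F \<subseteq> {s..s * exp h}"
  shows "measure M {\<omega> \<in> space M. \<forall>t\<in>F. c * sqrt t \<le> W t \<omega>} \<ge> (1 - \<Phi> (c + 3 * e)) / 2"
proof -
  interpret prob_space M using BM by (simp add: standard_brownian_motion_def)
  \<comment> \<open>Adding \<open>s\<close> to the times makes it the first grid point, so all drops
    are measured from the start of the block.\<close>
  define xs where "xs = sorted_list_of_set (insert s F)"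
  define u where "u i = xs ! i" for i
  define n where "n = length xs - 1"
  \<comment> \<open>Time 0 is put in front of the grid: increment 0 is then
    \<open>W s - W 0\<close>, and increment \<open>Suc i\<close> runs from \<open>u i\<close> to
    \<open>u (Suc i)\<close>.\<close>
  define ts where "ts = case_nat 0 u"
  \<comment> \<open>The allowed drop is \<open>2 * e\<close> times the square root of the right end
    \<open>s * exp h\<close> of the block.\<close>
  define a where "a = 2 * e * sqrt s * exp (h / 2)"
  have "0 < a" using assms by (simp add: a_def)
  have xs: "set xs = insert s F" "sorted_wrt (<) xs"
    unfolding xs_def using F by (simp_all only: set_sorted_list_of_set finite_insert strict_sorted_list_of_set)
  have "xs \<noteq> []" using xs(1) by auto
  then have len: "length xs = Suc n" by (simp add: n_def)
  have u_less: "u i < u j" if "i < j" "j \<le> n" for i j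
    using that len sorted_wrt_nth_less[OF xs(2)] by (simp add: u_def)
  have u_mem: "u i \<in> insert s F" if "i \<le> n" for i
    using that len nth_mem[of i xs] xs(1) by (simp add: u_def)
  have u_ex: "\<exists>i\<le>n. u i = t" if "t \<in> F" for t
    using that xs(1) len by (auto simp: u_def in_set_conv_nth less_Suc_eq_le dest!: equalityD2 subsetD[of _ _ t])
  have u_0: "u 0 = s"
  proof -
    obtain i where i: "i \<le> n" "u i = s"
      using xs(1) len by (auto simp: u_def in_set_conv_nth less_Suc_eq_le dest!: equalityD2)
    moreover have "s \<le> u 0" using u_mem[of 0] F by auto
    ultimately show ?thesis using u_less[of 0 i] by (cases i) auto
  qed
  have u_n: "u n - s \<le> s * (exp h - 1)"
    using u_mem[of n] F \<open>0 < s\<close> \<open>0 \<le> h\<close> by (auto simp: algebra_simps)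
  have meas[measurable]: "0 \<le> t \<Longrightarrow> W t \<in> borel_measurable M" for t
    using BM by (simp add: standard_brownian_motion_def)
  have u_nonneg: "0 \<le> u i" if "i \<le> n" for i
    using u_mem[OF that] F \<open>0 < s\<close> by auto
  \<comment> \<open>The event uses the increment from time 0, for which independence is available;
    \<open>W 0 = 0\<close> holds almost surely and enters at the final inclusion.\<close>
  define H where "H = {\<omega> \<in> space M. (c + 3 * e) * sqrt s \<le> W s \<omega> - W 0 \<omega>}"
  define G where "G = {\<omega> \<in> space M. \<forall>k\<in>{..n}. - a \<le> (\<Sum>i<k. W (u (Suc i)) \<omega> - W (u i) \<omega>)}"
  have S[measurable]: "(\<lambda>\<omega>. \<Sum>i<k. W (u (Suc i)) \<omega> - W (u i) \<omega>) \<in> borel_measurable M" if "k \<le> n" for k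
    using that u_nonneg by (intro borel_measurable_sum borel_measurable_diff meas) auto
  have H: "prob H \<ge> 1 - \<Phi> (c + 3 * e)"
    using centered_normal_tail_ge[OF brownian_increment_normal[OF BM, of 0 s]] \<open>0 < s\<close>
    by (simp add: H_def)
  have "prob {\<omega> \<in> space M. \<exists>k\<le>n. (\<Sum>i<k. W (u (Suc i)) \<omega> - W (u i) \<omega>) < - a} \<le> 1 / 2"
  proof -
    have ln8: "2 \<le> ln (8 :: real)"
    proof -
      have "ln (2 ^ 3 :: real) = 3 * ln 2" by (subst ln_realpow) auto
      then show ?thesis using ln2_ge_two_thirds by simp
    qed
    \<comment> \<open>Since ln 8 is at least 2, the variance \<open>u n - u 0\<close> is at most a
      quarter of the square of \<open>a\<close>; the factor 2 of the drop bound turns this quarter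
      into one half.\<close>
    have "exp h - 1 \<le> 2 * e\<^sup>2 / 2"
      using h2 divide_left_mono[OF ln8, of "2 * e\<^sup>2"] by simp
    also have "\<dots> \<le> e\<^sup>2 * exp h" using \<open>0 \<le> h\<close> mult_left_mono[of 1 "exp h" "e\<^sup>2"] by simp
    finally have "s * (exp h - 1) \<le> s * (e\<^sup>2 * exp h)"
      using \<open>0 < s\<close> by (intro mult_left_mono) auto
    also have "\<dots> = a\<^sup>2 / 4"
      using \<open>0 < s\<close> by (simp add: a_def power_mult_distrib flip: exp_double)
    finally have "(u n - u 0) / a\<^sup>2 \<le> 1 / 4"
      using u_n u_0 \<open>0 < a\<close> by (simp add: divide_simps)
    moreover have "prob {\<omega> \<in> space M. \<exists>k\<le>n. (\<Sum>i<k. W (u (Suc i)) \<omega> - W (u i) \<omega>) < - a}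
        \<le> 2 * ((u n - u 0) / a\<^sup>2)"
      using u_0 \<open>0 < s\<close> by (intro brownian_drop_prob BM u_less \<open>0 < a\<close>) auto
    ultimately show ?thesis by linarith
  qed
  moreover have "prob G = 1 - prob {\<omega> \<in> space M. \<exists>k\<le>n. (\<Sum>i<k. W (u (Suc i)) \<omega> - W (u i) \<omega>) < - a}"
  proof -
    have G_ev: "G \<in> events"
      unfolding G_def using S by (intro sets_Collect_ball_ge) auto
    have "{\<omega> \<in> space M. \<exists>k\<le>n. (\<Sum>i<k. W (u (Suc i)) \<omega> - W (u i) \<omega>) < - a} = space M - G"
      unfolding G_def not_le[symmetric] by blast
    with prob_compl[OF G_ev] show ?thesis by simp
  qed
  ultimately have G: "1 / 2 \<le> prob G" by linarith
  have HG: "prob (H \<inter> G) = prob H * prob G"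
  proof -
    let ?N = "\<lambda>I. Pi\<^sub>M I (\<lambda>_::nat. borel :: real measure)"
    let ?X = "\<lambda>i \<omega>. W (ts (Suc i)) \<omega> - W (ts i) \<omega>"
    let ?R = "\<lambda>I \<omega>. \<lambda>i\<in>I. ?X i \<omega>"
    let ?C = "{f \<in> space (?N {0}). (c + 3 * e) * sqrt s \<le> f 0}"
    let ?D = "{f \<in> space (?N {1..n}). \<forall>k\<in>{..n}. - a \<le> (\<Sum>i<k. f (Suc i))}"
    have "ts i < ts (Suc i)" if "i < Suc n" for i
      using that u_0 \<open>0 < s\<close> u_less by (cases i) (auto simp: ts_def)
    then have "indep_vars (\<lambda>_. borel) ?X {..<Suc n}"
      by (intro brownian_increments_indep BM) (simp_all add: ts_def)
    then have iv: "indep_var (?N {0}) (?R {0}) (?N {1..n}) (?R {1..n})"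
      by (rule indep_var_restrict) auto
    have C: "?C \<in> sets (?N {0})" by measurable
    have "(\<lambda>f. \<Sum>i<k. f (Suc i)) \<in> borel_measurable (?N {1..n})" if "k \<le> n" for k
      using that by (intro borel_measurable_sum measurable_component_singleton) auto
    then have D: "?D \<in> sets (?N {1..n})"
      by (intro sets_Collect_ball_ge) auto
    have eqC: "?R {0} -` ?C \<inter> space M = H"
      by (auto simp: H_def space_PiM ts_def u_0)
    have "(\<Sum>i<k. ?R {1..n} \<omega> (Suc i)) = (\<Sum>i<k. W (u (Suc i)) \<omega> - W (u i) \<omega>)"
      if "k \<le> n" for k \<omega>
      using that by (intro sum.cong) (auto simp: ts_def)
    then have eqD: "?R {1..n} -` ?D \<inter> space M = G"
      by (auto simp: G_def space_PiM)
    have "(\<lambda>x. (?R {0} x, ?R {1..n} x)) -` (?C \<times> ?D) \<inter> space M = H \<inter> G"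
      unfolding eqC[symmetric] eqD[symmetric] by auto
    with indep_varD[OF iv C D] show ?thesis
      unfolding eqC eqD by simp
  qed
  have "(1 - \<Phi> (c + 3 * e)) / 2 \<le> prob H * prob G"
    using H mult_left_mono[OF G, of "prob H"] by simp
  also have "\<dots> = prob (H \<inter> G)" using HG ..
  also have "\<dots> \<le> prob {\<omega> \<in> space M. \<forall>t\<in>F. c * sqrt t \<le> W t \<omega>}"
  proof (rule finite_measure_mono_AE)
    have F0: "0 \<le> t" if "t \<in> F" for t using that F \<open>0 < s\<close> by auto
    show "{\<omega> \<in> space M. \<forall>t\<in>F. c * sqrt t \<le> W t \<omega>} \<in> events"
      using F(1) meas[OF F0] by (rule sets_Collect_ball_ge)
    have "AE \<omega> in M. W 0 \<omega> = 0" using BM by (simp add: standard_brownian_motion_def)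
    then show "AE \<omega> in M. \<omega> \<in> H \<inter> G \<longrightarrow> \<omega> \<in> {\<omega> \<in> space M. \<forall>t\<in>F. c * sqrt t \<le> W t \<omega>}"
    proof eventually_elim
      case (elim \<omega>)
      show ?case
      proof (intro impI CollectI conjI ballI)
        assume \<omega>: "\<omega> \<in> H \<inter> G"
        then show "\<omega> \<in> space M" by (simp add: H_def)
        fix t assume t: "t \<in> F"
        then obtain k where k: "k \<le> n" "u k = t" using u_ex by blast
        have "- a \<le> W t \<omega> - W s \<omega>"
          using \<omega> k u_0 sum_lessThan_telescope[of "\<lambda>i. W (u i) \<omega>" k]
          by (auto simp: G_def dest!: bspec[of _ _ k])
        moreover have "(c + 3 * e) * sqrt s \<le> W s \<omega>"
          using \<omega> elim by (auto simp: H_def)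
        \<comment> \<open>Subtracting \<open>a\<close>, which is
          \<open>exp (h / 2) * (2 * e) * sqrt s\<close>, from the left side leaves
          \<open>c * (sqrt s * exp (h / 2))\<close>.\<close>
        moreover have "exp (h / 2) * (c + 2 * e) * sqrt s \<le> (c + 3 * e) * sqrt s"
          using h1 \<open>0 < s\<close> by (intro mult_right_mono) auto
        ultimately have "c * (sqrt s * exp (h / 2)) \<le> W t \<omega>"
          by (simp add: a_def algebra_simps)
        moreover have "sqrt t \<le> sqrt s * exp (h / 2)"
        proof -
          have "sqrt t \<le> sqrt (s * (exp (h / 2))\<^sup>2)"
            using t F by (intro real_sqrt_le_mono) (auto simp flip: exp_double)
          then show ?thesis by (simp add: real_sqrt_mult)
        qed
        ultimately show "c * sqrt t \<le> W t \<omega>"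
          using mult_left_mono[of "sqrt t" "sqrt s * exp (h / 2)" c] \<open>0 \<le> c\<close> by linarith
      qed
    qed
  qed
  finally show ?thesis .
qed

section \<open>From one block to the whole time range\<close>

lemma borel_measurable_of_bool_Collect:
  assumes "{x \<in> space N. P x} \<in> sets N"
  shows "(\<lambda>x. of_bool (P x) :: real) \<in> borel_measurable N"
  unfolding of_bool_def using assms by (intro measurable_If) auto

lemma geometric_grid_cover:
  fixes h y :: real
  assumes "0 < h" "0 \<le> y" "y \<le> L" "0 < L"
  shows "\<exists>i < nat \<lceil>L / h\<rceil>. h * i \<le> y \<and> y \<le> h * i + h"
proof -
  \<comment> \<open>A ceiling minus one keeps the index below the number of blocks when
    \<open>y = L\<close> is a multiple of \<open>h\<close>; truncated subtraction puts
    \<open>y = 0\<close> into block 0.\<close>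
  define i where "i = nat \<lceil>y / h\<rceil> - 1"
  have "nat \<lceil>y / h\<rceil> \<le> nat \<lceil>L / h\<rceil>"
    using assms by (intro nat_mono ceiling_mono divide_right_mono) auto
  moreover have "0 < nat \<lceil>L / h\<rceil>" using assms by simp
  ultimately have "i < nat \<lceil>L / h\<rceil>" unfolding i_def by linarith
  moreover have "real i \<le> y / h"
  proof (cases "y = 0")
    case False
    then have "0 < \<lceil>y / h\<rceil>" using assms by simp
    then have "real i = of_int \<lceil>y / h\<rceil> - 1" unfolding i_def by linarith
    then show ?thesis using ceiling_correct[of "y / h"] by linarith
  qed (simp add: i_def)
  moreover have "y / h \<le> real i + 1"
  proof -
    have "y / h \<le> real (nat \<lceil>y / h\<rceil>)" by (rule real_nat_ceiling_ge)
    also have "\<dots> \<le> real i + 1" by (simp add: i_def)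
    finally show ?thesis .
  qed
  ultimately show ?thesis using \<open>0 < h\<close> by (auto simp: field_simps)
qed

text \<open>Counting the nonnegative values among finitely many continuous functions is upper
  semicontinuous, so a point violating the lower bound has a violating rational neighbour.\<close>

lemma count_nonneg_dense:
  fixes g :: "'i \<Rightarrow> real \<Rightarrow> real"
  assumes I: "finite I" and g: "\<And>j. j \<in> I \<Longrightarrow> continuous_on {a..b} (g j)" and "a < b"
    and q: "\<And>t. t \<in> \<rat> \<Longrightarrow> t \<in> {a..b} \<Longrightarrow> q \<le> (\<Sum>j\<in>I. of_bool (0 \<le> g j t))"
    and s: "s \<in> {a..b}"
  shows "q \<le> (\<Sum>j\<in>I. of_bool (0 \<le> g j s) :: real)"
proof -
  \<comment> \<open>A function that is negative at \<open>s\<close> stays negative nearby, so no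
    index can count near \<open>s\<close> without counting at \<open>s\<close>.\<close>
  have "\<forall>j\<in>I. eventually (\<lambda>t. 0 \<le> g j t \<longrightarrow> 0 \<le> g j s) (at s within {a..b})"
  proof
    fix j assume "j \<in> I"
    then have lim: "(g j \<longlongrightarrow> g j s) (at s within {a..b})"
      using g s by (simp add: continuous_on_def)
    show "eventually (\<lambda>t. 0 \<le> g j t \<longrightarrow> 0 \<le> g j s) (at s within {a..b})"
    proof (cases "0 \<le> g j s")
      case False
      then have "eventually (\<lambda>t. g j t < 0) (at s within {a..b})"
        using order_tendstoD(2)[OF lim, of 0] by simp
      then show ?thesis by eventually_elim auto
    qed simp
  qed
  then have "eventually (\<lambda>t. \<forall>j\<in>I. 0 \<le> g j t \<longrightarrow> 0 \<le> g j s) (at s within {a..b})"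
    using I by (rule eventually_ball_finite[rotated])
  then obtain d where d: "0 < d"
      "\<And>t. t \<in> {a..b} \<Longrightarrow> t \<noteq> s \<Longrightarrow> dist t s < d \<Longrightarrow> \<forall>j\<in>I. 0 \<le> g j t \<longrightarrow> 0 \<le> g j s"
    unfolding eventually_at by blast
  \<comment> \<open>The window around \<open>s\<close> meets the open interval even if
    \<open>s\<close> is an endpoint.\<close>
  have "max a (s - d) < min b (s + d)" using s \<open>a < b\<close> \<open>0 < d\<close> by auto
  then obtain r where r: "r \<in> \<rat>" "max a (s - d) < r" "r < min b (s + d)"
    using Rats_dense_in_real by blast
  then have rs: "\<forall>j\<in>I. 0 \<le> g j r \<longrightarrow> 0 \<le> g j s"
    using d(2)[of r] by (cases "r = s") (auto simp: dist_real_def)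
  have "q \<le> (\<Sum>j\<in>I. of_bool (0 \<le> g j r))" using r by (intro q) auto
  also have "\<dots> \<le> (\<Sum>j\<in>I. of_bool (0 \<le> g j s))" using rs by (intro sum_mono) auto
  finally show ?thesis .
qed

text \<open>The tail probability \<open>4 * p\<close> is halved twice: the drop on a block leaves
  success probability \<open>2 * p\<close> for each motion, and the Chernoff bound then gives a
  fraction \<open>p\<close> of successes. The factor before the exponential is the number of blocks
  in the union bound.\<close>

lemma count_above_finite:
  fixes W :: "'i \<Rightarrow> real \<Rightarrow> 'a \<Rightarrow> real" and p :: real
  assumes "prob_space M" and I: "finite I"
    and BM: "\<And>j. j \<in> I \<Longrightarrow> standard_brownian_motion M (W j)"
    and ind: "independent_processes M I W"
    and "0 < \<tau>" "\<tau> < \<tau>'" "0 < e" "0 \<le> c" "0 < h" "0 \<le> p"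
    and h1: "exp (h / 2) * (c + 2 * e) \<le> c + 3 * e" and h2: "exp h - 1 \<le> 2 * e\<^sup>2 / ln 8"
    and p: "4 * p \<le> 1 - \<Phi> (c + 3 * e)"
    and F: "finite F" "F \<subseteq> {\<tau>..\<tau>'}"
  shows "measure M {\<omega> \<in> space M. \<forall>t\<in>F. p * card I \<le> (\<Sum>j\<in>I. of_bool (c * sqrt t \<le> W j t \<omega>))}
    \<ge> 1 - nat \<lceil>ln (\<tau>' / \<tau>) / h\<rceil> * exp (- p * card I / 4)"
proof -
  interpret prob_space M by fact
  define k where "k = nat \<lceil>ln (\<tau>' / \<tau>) / h\<rceil>"
  define s where "s i = \<tau> * exp (h * real i)" for i
  define E where "E i = F \<inter> {s i..s i * exp h}" for i
  \<comment> \<open>\<open>Z i j\<close> indicates that motion \<open>j\<close> stays above the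
    boundary at all times of \<open>F\<close> in block \<open>i\<close>.\<close>
  define Z where "Z i j \<omega> = (of_bool (\<forall>t\<in>E i. c * sqrt t \<le> W j t \<omega>) :: real)" for i j \<omega>
  define Bad where "Bad i = {\<omega> \<in> space M. (\<Sum>j\<in>I. Z i j \<omega>) < p * card I}" for i
  define Good where "Good = {\<omega> \<in> space M. \<forall>t\<in>F. p * card I \<le> (\<Sum>j\<in>I. of_bool (c * sqrt t \<le> W j t \<omega>))}"
  have s_pos: "0 < s i" for i using \<open>0 < \<tau>\<close> by (simp add: s_def)
  have F0: "0 \<le> t" if "t \<in> F" for t using that F \<open>0 < \<tau>\<close> by auto
  have W_meas: "W j t \<in> borel_measurable M" if "j \<in> I" "0 \<le> t" for j t
    using BM[OF that(1)] that(2) by (simp add: standard_brownian_motion_def)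
  have Z_ind: "indep_vars (\<lambda>_. borel) (Z i) I" for i
  proof -
    let ?P = "Pi\<^sub>M {0..} (\<lambda>_. borel) :: (real \<Rightarrow> real) measure"
    have E0: "t \<in> E i \<Longrightarrow> t \<in> {0..}" for t using F0 by (auto simp: E_def)
    \<comment> \<open>\<open>Z i j\<close> is a function of the path of motion \<open>j\<close>,
      measurable on the product space because \<open>E i\<close> is finite; independence of the
      processes therefore passes to the indicators.\<close>
    have "{f \<in> space ?P. \<forall>t\<in>E i. c * sqrt t \<le> f t} \<in> sets ?P"
      using F(1) E0 by (intro sets_Collect_ball_ge measurable_component_singleton) (auto simp: E_def)
    then have "(\<lambda>f. of_bool (\<forall>t\<in>E i. c * sqrt t \<le> f t) :: real) \<in> borel_measurable ?P"
      by (rule borel_measurable_of_bool_Collect)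
    with ind have "indep_vars (\<lambda>_. borel)
        (\<lambda>j \<omega>. of_bool (\<forall>t\<in>E i. c * sqrt t \<le> (\<lambda>t\<in>{0..}. W j t \<omega>) t) :: real) I"
      unfolding independent_processes_def by (rule indep_vars_compose2)
    also have "(\<lambda>j \<omega>. of_bool (\<forall>t\<in>E i. c * sqrt t \<le> (\<lambda>t\<in>{0..}. W j t \<omega>) t) :: real) = Z i"
      using E0 by (auto simp: Z_def fun_eq_iff)
    finally show ?thesis .
  qed
  have Z_meas: "Z i j \<in> borel_measurable M" if "j \<in> I" for i j
    using Z_ind that by (auto simp: indep_vars_def)
  have Z_exp: "2 * p \<le> expectation (Z i j)" if "j \<in> I" for i j
  proof -
    have "{\<omega> \<in> space M. \<forall>t\<in>E i. c * sqrt t \<le> W j t \<omega>} \<in> events"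
      using F(1) F0 by (intro sets_Collect_ball_ge W_meas that) (auto simp: E_def)
    then have "expectation (Z i j) = prob {\<omega> \<in> space M. \<forall>t\<in>E i. c * sqrt t \<le> W j t \<omega>}"
      by (subst Bochner_Integration.integral_cong[OF refl,
            of M _ "indicator {\<omega> \<in> space M. \<forall>t\<in>E i. c * sqrt t \<le> W j t \<omega>}"])
         (auto simp: Z_def indicator_def)
    moreover have "(1 - \<Phi> (c + 3 * e)) / 2 \<le> prob {\<omega> \<in> space M. \<forall>t\<in>E i. c * sqrt t \<le> W j t \<omega>}"
      using assms s_pos by (intro brownian_stays_above_finite[where s = "s i" and h = h] BM that)
        (auto simp: E_def)
    ultimately show ?thesis using p by simp
  qed
  have Bad: "prob (Bad i) \<le> exp (- p * card I / 4)" for i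
    unfolding Bad_def
    by (rule Chernoff_lower_tail[OF I Z_ind]) (use Z_exp \<open>0 \<le> p\<close> in \<open>auto simp: Z_def\<close>)
  have Bad_ev: "Bad i \<in> events" for i
    unfolding Bad_def using Z_meas by (intro borel_measurable_less borel_measurable_sum) auto
  have Good_ev: "Good \<in> events"
    unfolding Good_def
  proof (intro sets_Collect_ball_ge borel_measurable_sum borel_measurable_of_bool_Collect F(1))
    fix t j assume "t \<in> F" "j \<in> I"
    then show "{\<omega> \<in> space M. c * sqrt t \<le> W j t \<omega>} \<in> events"
      using F0 W_meas by (intro borel_measurable_le) auto
  qed
  have "space M - Good \<subseteq> (\<Union>i<k. Bad i)"
  proof
    fix \<omega> assume "\<omega> \<in> space M - Good"
    then obtain t where \<omega>: "\<omega> \<in> space M" and t: "t \<in> F"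
      and less: "(\<Sum>j\<in>I. of_bool (c * sqrt t \<le> W j t \<omega>)) < p * card I"
      by (auto simp: Good_def not_le)
    have t': "\<tau> \<le> t" "t \<le> \<tau>'" using t F by auto
    have "\<exists>i<k. h * real i \<le> ln (t / \<tau>) \<and> ln (t / \<tau>) \<le> h * real i + h"
      unfolding k_def using t' \<open>0 < \<tau>\<close> \<open>\<tau> < \<tau>'\<close> \<open>0 < h\<close>
      by (intro geometric_grid_cover) (auto intro!: divide_right_mono)
    then obtain i where i: "i < k" "h * real i \<le> ln (t / \<tau>)" "ln (t / \<tau>) \<le> h * real i + h"
      by blast
    have "exp (ln (t / \<tau>)) = t / \<tau>" using t' \<open>0 < \<tau>\<close> by simp
    then have "exp (h * real i) \<le> t / \<tau>" "t / \<tau> \<le> exp (h * real i + h)"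
      using i(2,3) by (metis exp_le_cancel_iff)+
    then have tE: "t \<in> E i"
      using t \<open>0 < \<tau>\<close> by (auto simp: E_def s_def exp_add field_simps)
    \<comment> \<open>A motion above the boundary throughout block \<open>i\<close> is above it at
      \<open>t\<close>, so a low count at \<open>t\<close> makes block \<open>i\<close> bad.\<close>
    have "(\<Sum>j\<in>I. Z i j \<omega>) \<le> (\<Sum>j\<in>I. of_bool (c * sqrt t \<le> W j t \<omega>))"
      using tE by (intro sum_mono) (auto simp: Z_def)
    also note less
    finally show "\<omega> \<in> (\<Union>i<k. Bad i)" using i(1) \<omega> by (auto simp: Bad_def)
  qed
  then have "prob (space M - Good) \<le> prob (\<Union>i<k. Bad i)"
    using Bad_ev by (intro finite_measure_mono) auto
  also have "\<dots> \<le> (\<Sum>i<k. prob (Bad i))"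
    using Bad_ev by (intro finite_measure_subadditive_finite) auto
  also have "\<dots> \<le> (\<Sum>i<k. exp (- p * card I / 4))"
    using Bad by (intro sum_mono)
  finally show ?thesis
    using prob_compl[OF Good_ev] by (simp add: Good_def k_def)
qed

section \<open>From finitely many times to all times\<close>

text \<open>\<open>A\<close> agrees with \<open>B\<close> up to a subset of a null set, so the
  completion measures it. This carries the bound from rational times, a countable condition, to the
  infimum over all times.\<close>

lemma (in prob_space) measure_completion_ge:
  assumes "B \<in> sets M" "A \<subseteq> space M" and AE: "AE x in M. x \<in> A \<longleftrightarrow> x \<in> B"
  shows "measure (completion M) A \<ge> measure M B"
proof -
  interpret completion: prob_space "completion M" by (rule prob_space_completion)
  from AE obtain N where N: "{x \<in> space M. \<not> (x \<in> A \<longleftrightarrow> x \<in> B)} \<subseteq> N" "N \<in> null_sets M"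
    by (auto simp: eventually_ae_filter)
  have B: "B \<subseteq> space M" using \<open>B \<in> sets M\<close> by (rule sets.sets_into_space)
  have A: "A = (B - N) \<union> (A \<inter> N)" using N(1) B \<open>A \<subseteq> space M\<close> by blast
  have A_sets: "A \<in> sets (completion M)"
    by (rule sets_completionI[OF A, of N]) (use N \<open>B \<in> sets M\<close> in auto)
  have "measure M B = measure M (B - N)"
    using N \<open>B \<in> sets M\<close> by (simp add: measure_Diff_null_set)
  also have "\<dots> = measure (completion M) (B - N)"
    using N \<open>B \<in> sets M\<close> by (subst measure_completion) auto
  also have "\<dots> \<le> measure (completion M) A"
    using A A_sets by (intro completion.finite_measure_mono) auto
  finally show ?thesis .
qed

text \<open>The bound for finite sets of times does not depend on the set, so it survives the limit
  along finite sets exhausting the rational times; almost sure continuity does the rest. The three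
  last hypotheses isolate what is needed of \<open>h\<close> and \<open>e\<close>.\<close>

lemma uniform_fraction_boundI:
  fixes M :: "'a measure"
  assumes "prob_space M"
    and "0 < \<tau>" "\<tau> < \<tau>'" "0 < e" "0 \<le> c" "0 < h" "0 < p"
    and h1: "exp (h / 2) * (c + 2 * e) \<le> c + 3 * e" and h2: "exp h - 1 \<le> 2 * e\<^sup>2 / ln 8"
    and p: "4 * p \<le> 1 - \<Phi> (c + 3 * e)"
  shows "uniform_fraction_bound M \<tau> \<tau>' c p h"
  unfolding uniform_fraction_bound_def
proof (intro allI impI)
  interpret prob_space M by fact
  fix m :: nat and W :: "nat \<Rightarrow> real \<Rightarrow> 'a \<Rightarrow> real" and \<delta> :: real
  assume BM: "\<forall>j\<in>{1..m}. standard_brownian_motion M (W j)"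
    and ind: "independent_processes M {1..m} W" and \<delta>: "0 < \<delta>" "\<delta> < 1"
    and m: "4 / p * ln (real_of_int \<lceil>ln (\<tau>' / \<tau>) / h\<rceil> / \<delta>) \<le> real m"
  define k where "k = nat \<lceil>ln (\<tau>' / \<tau>) / h\<rceil>"
  define cnt where "cnt t \<omega> = (\<Sum>j=1..m. of_bool (c * sqrt t \<le> W j t \<omega>) :: real)" for t \<omega>
  have k_pos: "0 < \<lceil>ln (\<tau>' / \<tau>) / h\<rceil>"
    using assms by simp
  then have k: "real_of_int \<lceil>ln (\<tau>' / \<tau>) / h\<rceil> = real k" "1 \<le> k"
    unfolding k_def by linarith+
  \<comment> \<open>There is at least one block and \<open>\<delta> < 1\<close>, so the condition on
    \<open>m\<close> forces \<open>m\<close> to be positive and division by \<open>m\<close> is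
    harmless.\<close>
  have "0 < ln (k / \<delta>)" using k(2) \<delta> by (subst ln_gt_zero_iff) (auto simp: field_simps)
  then have "0 < 4 / p * ln (k / \<delta>)" using \<open>0 < p\<close> by simp
  then have m_pos: "0 < m" using m unfolding k(1) by linarith
  have union_bound: "k * exp (- p * m / 4) \<le> \<delta>"
  proof -
    have "ln (k / \<delta>) \<le> p * m / 4" using m \<open>0 < p\<close> unfolding k(1) by (simp add: field_simps)
    then have "k / \<delta> \<le> exp (p * m / 4)" using k(2) \<delta> exp_le_cancel_iff[of "ln (k / \<delta>)"] by simp
    then show ?thesis using \<delta> by (simp add: exp_minus field_simps)
  qed
  have fin: "1 - \<delta> \<le> prob {\<omega> \<in> space M. \<forall>t\<in>F. p * m \<le> cnt t \<omega>}"
    if "finite F" "F \<subseteq> {\<tau>..\<tau>'}" for F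
    using count_above_finite[OF \<open>prob_space M\<close> _ _ ind \<open>0 < \<tau>\<close> \<open>\<tau> < \<tau>'\<close> \<open>0 < e\<close> \<open>0 \<le> c\<close> \<open>0 < h\<close>
        _ h1 h2 p that] BM \<open>0 < p\<close> union_bound by (simp add: cnt_def k_def)
  have W_meas: "W j t \<in> borel_measurable M" if "j \<in> {1..m}" "0 \<le> t" for j t
    using BM that by (simp add: standard_brownian_motion_def)
  have cnt_meas: "cnt t \<in> borel_measurable M" if "t \<in> {\<tau>..\<tau>'}" for t
    unfolding cnt_def[abs_def]
  proof (intro borel_measurable_sum borel_measurable_of_bool_Collect)
    fix j assume "j \<in> {1..m}"
    then show "{\<omega> \<in> space M. c * sqrt t \<le> W j t \<omega>} \<in> events"
      using W_meas[of j t] that \<open>0 < \<tau>\<close> by (intro borel_measurable_le) auto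
  qed
  define D where "D = \<rat> \<inter> {\<tau>..\<tau>'}"
  define d where "d = from_nat_into D"
  obtain r where "r \<in> \<rat>" "\<tau> < r" "r < \<tau>'"
    using Rats_dense_in_real[OF \<open>\<tau> < \<tau>'\<close>] by blast
  then have "D \<noteq> {}" by (auto simp: D_def)
  moreover have "countable D" unfolding D_def using countable_rat by (rule countable_subset[rotated]) auto
  ultimately have d: "range d = D" unfolding d_def by (rule range_from_nat_into)
  \<comment> \<open>The events \<open>G N\<close> decrease to the event \<open>B\<close> for all
    rational times, and each has probability at least \<open>1 - \<delta>\<close>.\<close>
  define G where "G N = {\<omega> \<in> space M. \<forall>t\<in>d ` {..<N}. p * m \<le> cnt t \<omega>}" for N
  define B where "B = (\<Inter>N. G N)"
  have dF: "d ` {..<N} \<subseteq> {\<tau>..\<tau>'}" for N using d by (auto simp: D_def)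
  have G_ev: "G N \<in> events" for N
    unfolding G_def using subsetD[OF dF] by (intro sets_Collect_ball_ge cnt_meas) blast+
  then have B_ev: "B \<in> events" unfolding B_def by auto
  have "(\<lambda>N. prob (G N)) \<longlonglongrightarrow> prob B"
    unfolding B_def using G_ev by (intro finite_Lim_measure_decseq) (auto simp: decseq_def G_def)
  then have B_prob: "1 - \<delta> \<le> prob B"
    using fin[OF _ dF] by (intro LIMSEQ_le_const) (auto simp: G_def)
  have B_eq: "B = {\<omega> \<in> space M. \<forall>t\<in>D. p * m \<le> cnt t \<omega>}"
    unfolding B_def G_def d[symmetric] by auto
  let ?A = "{\<omega> \<in> space M. p \<le>
    (INF t\<in>{\<tau>..\<tau>'}. 1 / real m * (\<Sum>j=1..m. of_bool (c \<le> W j t \<omega> / sqrt t)))}"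
  have A_iff: "\<omega> \<in> ?A \<longleftrightarrow> \<omega> \<in> space M \<and> (\<forall>t\<in>{\<tau>..\<tau>'}. p * m \<le> cnt t \<omega>)" for \<omega>
  proof -
    \<comment> \<open>The real infimum can be compared pointwise because the family is bounded below
      and the interval is nonempty.\<close>
    have "bdd_below ((\<lambda>t. 1 / real m * (\<Sum>j=1..m. of_bool (c \<le> W j t \<omega> / sqrt t))) ` {\<tau>..\<tau>'})"
      by (rule bdd_belowI2[of _ 0]) (auto intro!: sum_nonneg)
    then have "p \<le> (INF t\<in>{\<tau>..\<tau>'}. 1 / real m * (\<Sum>j=1..m. of_bool (c \<le> W j t \<omega> / sqrt t)))
        \<longleftrightarrow> (\<forall>t\<in>{\<tau>..\<tau>'}. p \<le> 1 / real m * (\<Sum>j=1..m. of_bool (c \<le> W j t \<omega> / sqrt t)))"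
      using \<open>\<tau> < \<tau>'\<close> by (intro le_cINF_iff) auto
    also have "\<dots> \<longleftrightarrow> (\<forall>t\<in>{\<tau>..\<tau>'}. p * m \<le> cnt t \<omega>)"
    proof (intro ball_cong refl)
      fix t assume "t \<in> {\<tau>..\<tau>'}"
      then have "0 < sqrt t" using \<open>0 < \<tau>\<close> by simp
      then show "p \<le> 1 / real m * (\<Sum>j=1..m. of_bool (c \<le> W j t \<omega> / sqrt t)) \<longleftrightarrow> p * m \<le> cnt t \<omega>"
        using m_pos by (simp add: cnt_def pos_le_divide_eq)
    qed
    finally show ?thesis by simp
  qed
  have "AE \<omega> in M. \<forall>j\<in>{1..m}. continuous_on {0..} (\<lambda>t. W j t \<omega>)"
    using BM by (intro AE_finite_allI) (auto simp: standard_brownian_motion_def)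
  then have "AE \<omega> in M. \<omega> \<in> ?A \<longleftrightarrow> \<omega> \<in> B"
  proof eventually_elim
    case (elim \<omega>)
    have "p * m \<le> cnt t \<omega>" if rat: "\<forall>t\<in>D. p * m \<le> cnt t \<omega>" and t: "t \<in> {\<tau>..\<tau>'}" for t
    proof -
      have "p * m \<le> (\<Sum>j=1..m. of_bool (0 \<le> W j t \<omega> - c * sqrt t))"
      proof (rule count_nonneg_dense[OF _ _ \<open>\<tau> < \<tau>'\<close> _ t])
        fix j assume "j \<in> {1..m}"
        then have "continuous_on {\<tau>..\<tau>'} (\<lambda>t. W j t \<omega>)"
          using continuous_on_subset[OF bspec[OF elim], of j] \<open>0 < \<tau>\<close> by simp
        then show "continuous_on {\<tau>..\<tau>'} (\<lambda>t. W j t \<omega> - c * sqrt t)"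
          by (intro continuous_intros)
      qed (use rat in \<open>auto simp: D_def cnt_def\<close>)
      then show ?thesis by (simp add: cnt_def)
    qed
    then show ?case
      unfolding A_iff B_eq by (auto simp: D_def)
  qed
  then have "prob B \<le> measure (completion M) ?A"
    using B_ev by (intro measure_completion_ge) auto
  with B_prob show "1 - \<delta> \<le> measure (completion M) ?A" by linarith
qed

section \<open>Admissible block lengths\<close>

theorem theorem7:
  fixes \<tau> \<tau>' c p :: real
  assumes "0 < \<tau>" and "\<tau> < \<tau>'" and "0 < c" and "0 < p" and "p < p0 c"
  shows "(\<exists>h. 0 < h \<and> h \<le> 1 \<and>
            (\<forall>M :: 'a measure. prob_space M \<longrightarrow> uniform_fraction_bound M \<tau> \<tau>' c p h))
       \<and> (\<forall>h. 0 < h \<longrightarrow> h \<le> h_star c p \<longrightarrow>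
            (\<forall>M :: 'a measure. prob_space M \<longrightarrow> uniform_fraction_bound M \<tau> \<tau>' c p h))
       \<and> (c \<le> 1 / 20 \<longrightarrow> p \<le> 1 / 10 \<longrightarrow> 1 / 250 \<le> h_star c p)"
proof -
  define e where "e = eps c p"
  have "0 \<le> \<Phi> c" by (simp add: \<Phi>_def cdf_def)
  then have "4 * p < 1 - \<Phi> c" "4 * p < 1" using \<open>p < p0 c\<close> by (simp_all add: p0_def)
  \<comment> \<open>By the choice of \<open>eps\<close>, the starting level \<open>c + 3 * e\<close>
    is the quantile whose upper tail is exactly \<open>4 * p\<close>.\<close>
  moreover have "c + 3 * e = \<Phi>_inv (1 - 4 * p)" by (simp add: e_def eps_def field_simps)
  ultimately have \<Phi>: "\<Phi> (c + 3 * e) = 1 - 4 * p"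
    using \<Phi>_inv_cancel[of "1 - 4 * p"] \<open>0 < p\<close> by simp
  have "\<not> c + 3 * e \<le> c"
    using \<Phi>_mono[of "c + 3 * e" c] \<Phi> \<open>4 * p < 1 - \<Phi> c\<close> by linarith
  then have e: "0 < e" by simp
  have ln8: "0 < ln (8 :: real)" by simp
  have bound: "uniform_fraction_bound M \<tau> \<tau>' c p h"
    if h: "0 < h" "h \<le> h_star c p" and "prob_space M" for h and M :: "'a measure"
  proof (rule uniform_fraction_boundI[where e = e])
    \<comment> \<open>Exponentiating the two logarithmic terms of the minimum gives the two
      conditions on \<open>h\<close>.\<close>
    have hs: "h \<le> 2 * ln ((c + 3 * e) / (c + 2 * e))" "h \<le> ln (1 + 2 * e\<^sup>2 / ln 8)"
      using h by (auto simp: h_star_def e_def)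
    have pos: "0 < (c + 3 * e) / (c + 2 * e)" using e \<open>0 < c\<close> by simp
    have "h / 2 \<le> ln ((c + 3 * e) / (c + 2 * e))" using hs(1) by simp
    then have "exp (h / 2) \<le> (c + 3 * e) / (c + 2 * e)"
      by (rule iffD1[OF ln_ge_iff[OF pos]])
    then show "exp (h / 2) * (c + 2 * e) \<le> c + 3 * e"
      using e \<open>0 < c\<close> by (simp add: pos_le_divide_eq)
    have "0 < 1 + 2 * e\<^sup>2 / ln 8" using ln8 by (intro add_pos_nonneg) auto
    then show "exp h - 1 \<le> 2 * e\<^sup>2 / ln 8" using hs(2) by (simp add: ln_ge_iff)
  qed (use assms e h \<Phi> \<open>prob_space M\<close> in auto)
  \<comment> \<open>Being positive and at most 1, \<open>h_star c p\<close> itself witnesses the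
    existence claim.\<close>
  have "0 < h_star c p"
  proof -
    have "0 < ln ((c + 3 * e) / (c + 2 * e))"
      using e \<open>0 < c\<close> by (intro ln_gt_zero) (simp add: field_simps)
    moreover have "0 < ln (1 + 2 * e\<^sup>2 / ln 8)"
      using e ln8 by (intro ln_gt_zero) simp
    ultimately show ?thesis by (simp add: h_star_def flip: e_def)
  qed
  moreover have "h_star c p \<le> 1" by (simp add: h_star_def)
  ultimately show ?thesis
    using bound h_star_numeric[OF \<open>0 < c\<close> _ \<open>0 < p\<close>] by blast
qed

end
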